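(* Let $\alpha$ be an umbra with real moments and let $\kappa_\alpha$ be the $\alpha$-cumulant umbra. For every nonnegative integer $k$, the family of polynomials, indexed by $t\ge0$, $$Q_k(x,t)=E[(x-t\mathbf{.}\beta\mathbf{.}\kappa_\alpha)^k]\in\mathbb{R}[x]$$ is time-space harmonic with respect to $\{t\mathbf{.}\alpha\}_{t\ge0}$.
   Context: An umbra $\alpha$ is a symbol representing a sequence $a_0=1,a_1,a_2,\ldots$ of real numbers through a linear evaluation functional $E$ with $E[\alpha^n]=a_n$ (the $n$-th moment); $E$ is linear over $\mathbb{R}[x]$, $E[1]=1$, and $E$ is multiplicative on monomials in distinct (uncorrelated) umbrae. The generating function of $\alpha$ is the formal power series $f(\alpha,z)=\sum_{n\ge0}a_nz^n/n!$. For $t\in\mathbb{R}$, $t\mathbf{.}\alpha$ is the auxiliary umbra with generating function $f(t\mathbf{.}\alpha,z)=f(\alpha,z)^t$, i.e. $E[(t\mathbf{.}\alpha)^i]=\sum_{m=1}^i (t)_m B_{i,m}(a_1,\ldots,a_{i-m+1})$ for $i\ge1$, where $(t)_m=t(t-1)\cdots(t-m+1)$ and $B_{i,m}$ are the partial exponential Bell polynomials. The $\alpha$-cumulant umbra $\kappa_\alpha$ is the umbra whose moments $h_n=E[\kappa_\alpha^n]$, $n\ge1$, are the formal cumulants of $\{a_n\}$: $f(\alpha,z)=\exp[f(\kappa_\alpha,z)-1]$. For an umbra $\gamma$ with moments $g_n$ and $t\in\mathbb{R}$, $t\mathbf{.}\beta\mathbf{.}\gamma$ ($\beta$ the Bell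 umbra, whose moments are the Bell numbers) is the auxiliary umbra with generating function $\exp[t(f(\gamma,z)-1)]$, i.e. $E[(t\mathbf{.}\beta\mathbf{.}\gamma)^i]=\sum_{m=1}^i t^mB_{i,m}(g_1,\ldots,g_{i-m+1})$ for $i\ge1$. $x-t\mathbf{.}\beta\mathbf{.}\gamma$ means $x+(-t)\mathbf{.}\beta\mathbf{.}\gamma$; its powers are expanded by the binomial theorem and evaluated linearly with $E$. Conditional evaluation: for $0\le s\le t$, $E[\,\cdot\mid s\mathbf{.}\alpha]$ is the linear map from real polynomials in the symbol $t\mathbf{.}\alpha$ to real polynomials in the symbol $s\mathbf{.}\alpha$ (which is treated as an indeterminate) given by $E[(t\mathbf{.}\alpha)^k\mid s\mathbf{.}\alpha]=\sum_{j=0}^k\binom{k}{j}(s\mathbf{.}\alpha)^j\,E[((t-s)\mathbf{.}\alpha')^{k-j}]$, where $\alpha'$ is an umbra uncorrelated with $\alpha$ and with the same moments. A family $\{P(x,t)\}_{t\ge0}\subset\mathbb{R}[x]$ is time-space harmonic with respect to $\{t\mathbf{.}\alpha\}_{t\ge0}$ if $E[P(t\mathbf{.}\alpha,t)\mid s\mathbf{.}\alpha]=P(s\mathbf{.}\alpha,s)$ for all $0\le s\le t$, as polynomials in the symbol $s\mathbf{.}\alpha$. *)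

theory Defs
  imports
    "HOL-Computational_Algebra.Polynomial"
    "HOL-Computational_Algebra.Formal_Power_Series"
begin

text \<open>
  An umbra enters only through its moments, so it is represented by its moment sequence
  \<^term>\<open>a :: nat \<Rightarrow> real\<close>, where \<^term>\<open>a n\<close> is $E[\alpha^n]$; the only constraint is $E[\alpha^0] = 1$.
\<close>

definition is_umbra :: "(nat \<Rightarrow> real) \<Rightarrow> bool" where
  "is_umbra a \<longleftrightarrow> a 0 = 1"

definition gen_fun :: "(nat \<Rightarrow> real) \<Rightarrow> real fps" where
  "gen_fun a = Abs_fps (\<lambda>n. a n / fact n)"

definition umbra_of :: "real fps \<Rightarrow> nat \<Rightarrow> real" where
  "umbra_of F = (\<lambda>n. fact n * fps_nth F n)"

lemma gen_fun_umbra_of [simp]: "gen_fun (umbra_of F) = F"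
  by (simp add: gen_fun_def umbra_of_def fps_eq_iff)

lemma umbra_of_gen_fun [simp]: "umbra_of (gen_fun a) = a"
  by (simp add: gen_fun_def umbra_of_def fun_eq_iff)

lemma gen_fun_nth_0: "is_umbra a \<Longrightarrow> fps_nth (gen_fun a) 0 = 1"
  by (simp add: gen_fun_def is_umbra_def)

text \<open>
  $f^t = \sum_m {t \choose m} (f - 1)^m$ and $\exp g = \sum_m g^m / m!$; these are meaningful for
  constant terms $1$ and $0$ respectively.  As $(f(\alpha,z) - 1)^m / m!$ is the exponential
  generating function of the partial Bell polynomials in the moments of $\alpha$, the $i$-th
  moments of $t\mathbf{.}\alpha$ (\<open>dot\<close>) and $t\mathbf{.}\beta\mathbf{.}\gamma$ (\<open>dot_bell_dot\<close>) are
  $\sum_m (t)_m B_{i,m}(a_1,\ldots)$ and $\sum_m t^m B_{i,m}(g_1,\ldots)$.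
\<close>

definition fps_real_power :: "real fps \<Rightarrow> real \<Rightarrow> real fps" where
  "fps_real_power F t = fps_binomial t oo (F - 1)"

definition fps_expo :: "real fps \<Rightarrow> real fps" where
  "fps_expo G = fps_exp 1 oo G"

definition dot :: "real \<Rightarrow> (nat \<Rightarrow> real) \<Rightarrow> nat \<Rightarrow> real" where
  "dot t a = umbra_of (fps_real_power (gen_fun a) t)"

definition dot_bell_dot :: "real \<Rightarrow> (nat \<Rightarrow> real) \<Rightarrow> nat \<Rightarrow> real" where
  "dot_bell_dot t g = umbra_of (fps_expo (fps_const t * (gen_fun g - 1)))"

lemma dot_of_nat:
  assumes "is_umbra a"
  shows "gen_fun (dot (real n) a) = gen_fun a ^ n"
proof -
  have "fps_nth (gen_fun a - 1) 0 = 0"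
    using assms by (simp add: gen_fun_nth_0)
  then have "((1 + fps_X) ^ n) oo (gen_fun a - 1) = gen_fun a ^ n"
    by (simp add: fps_compose_power [symmetric] fps_compose_add_distrib)
  then show ?thesis
    by (simp add: dot_def fps_real_power_def fps_binomial_of_nat)
qed

definition is_cumulant_umbra :: "(nat \<Rightarrow> real) \<Rightarrow> (nat \<Rightarrow> real) \<Rightarrow> bool" where
  "is_cumulant_umbra a h \<longleftrightarrow> is_umbra h \<and> gen_fun a = fps_expo (gen_fun h - 1)"

definition cumulant_umbra :: "(nat \<Rightarrow> real) \<Rightarrow> nat \<Rightarrow> real" where
  "cumulant_umbra a = (THE h. is_cumulant_umbra a h)"

lemma ex1_cumulant_umbra:
  assumes "is_umbra a"
  shows "\<exists>!h. is_cumulant_umbra a h"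
proof -
  define u where "u = fps_exp (1::real) - 1"
  have u: "fps_nth u 0 = 0" "fps_nth u 1 \<noteq> 0"
    by (simp_all add: u_def)
  have inv0: "fps_nth (fps_inv u) 0 = 0"
    by (simp add: fps_inv_def)
  have expo: "fps_expo G = 1 + (u oo G)" for G
    by (simp add: fps_expo_def u_def fps_compose_sub_distrib)
  have a0: "fps_nth (gen_fun a - 1) 0 = 0"
    using assms by (simp add: gen_fun_nth_0)
  have iff: "fps_expo G = gen_fun a \<longleftrightarrow> G = fps_inv u oo (gen_fun a - 1)"
    if G: "fps_nth G 0 = 0" for G
  proof
    assume "fps_expo G = gen_fun a"
    then have "u oo G = gen_fun a - 1"
      by (simp add: expo algebra_simps)
    moreover have "fps_inv u oo (u oo G) = G"
      using fps_compose_assoc [OF G u(1), of "fps_inv u"] fps_inv [OF u] G by simp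
    ultimately show "G = fps_inv u oo (gen_fun a - 1)"
      by simp
  next
    assume "G = fps_inv u oo (gen_fun a - 1)"
    then have "u oo G = gen_fun a - 1"
      using fps_compose_assoc [OF a0 inv0, of u] fps_inv_right [OF u] a0 by simp
    then show "fps_expo G = gen_fun a"
      by (simp add: expo)
  qed
  define H where "H = fps_inv u oo (gen_fun a - 1)"
  show ?thesis
  proof
    have H0: "fps_nth H 0 = 0"
      by (simp add: H_def inv0)
    have "is_umbra (umbra_of (1 + H))"
      using H0 by (simp add: is_umbra_def umbra_of_def)
    moreover have "gen_fun a = fps_expo H"
      using iff [OF H0] H_def by simp
    ultimately show "is_cumulant_umbra a (umbra_of (1 + H))"
      by (simp add: is_cumulant_umbra_def)
  next
    fix h assume h: "is_cumulant_umbra a h"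
    then have "gen_fun h - 1 = H"
      using iff [of "gen_fun h - 1"]
      by (simp add: is_cumulant_umbra_def H_def gen_fun_nth_0)
    then have "gen_fun h = 1 + H"
      by (simp add: algebra_simps)
    then show "h = umbra_of (1 + H)"
      by (metis umbra_of_gen_fun)
  qed
qed

lemma cumulant_umbra:
  "is_umbra a \<Longrightarrow> is_cumulant_umbra a (cumulant_umbra a)"
  unfolding cumulant_umbra_def by (rule theI' [OF ex1_cumulant_umbra])

text \<open>
  Elements of $\mathbb{R}[x][\gamma]$ have type \<^typ>\<open>real poly poly\<close>: the outer indeterminate is
  the umbra $\gamma$ and the coefficients are polynomials in $x$.  The evaluation $E$ is
  $\mathbb{R}[x]$-linear and sends $\gamma^i$ to the $i$-th moment \<^term>\<open>g i\<close>.
\<close>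

definition umbral_eval :: "(nat \<Rightarrow> real) \<Rightarrow> real poly poly \<Rightarrow> real poly" where
  "umbral_eval g p = (\<Sum>i\<le>degree p. smult (g i) (coeff p i))"

text \<open>
  $Q_k(x,t) = E[(x + (-t)\mathbf{.}\beta\mathbf{.}\kappa_\alpha)^k]$; the polynomial
  \<^term>\<open>[:[:0, 1:], 1:] :: real poly poly\<close> is $x + \gamma$.
\<close>

definition Q :: "(nat \<Rightarrow> real) \<Rightarrow> nat \<Rightarrow> real \<Rightarrow> real poly" where
  "Q a k t = umbral_eval (dot_bell_dot (- t) (cumulant_umbra a)) ([:[:0, 1:], 1:] ^ k)"

text \<open>
  $E[\,\cdot\mid s\mathbf{.}\alpha]$, first on the power $(t\mathbf{.}\alpha)^k$ and then extended
  linearly.  Arguments are polynomials in the indeterminate $t\mathbf{.}\alpha$, values are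
  polynomials in the indeterminate $s\mathbf{.}\alpha$.
\<close>

definition cond_eval_power :: "(nat \<Rightarrow> real) \<Rightarrow> real \<Rightarrow> real \<Rightarrow> nat \<Rightarrow> real poly" where
  "cond_eval_power a s t k =
     (\<Sum>j\<le>k. monom (of_nat (k choose j) * dot (t - s) a (k - j)) j)"

definition cond_eval :: "(nat \<Rightarrow> real) \<Rightarrow> real \<Rightarrow> real \<Rightarrow> real poly \<Rightarrow> real poly" where
  "cond_eval a s t p = (\<Sum>k\<le>degree p. smult (coeff p k) (cond_eval_power a s t k))"

text \<open>
  \<^term>\<open>P t :: real poly\<close> is $P(x,t)$.  Substituting an umbral symbol for $x$ only renames the
  indeterminate.
\<close>

definition time_space_harmonic :: "(nat \<Rightarrow> real) \<Rightarrow> (real \<Rightarrow> real poly) \<Rightarrow> bool" where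
  "time_space_harmonic a P \<longleftrightarrow>
     (\<forall>s t. 0 \<le> s \<longrightarrow> s \<le> t \<longrightarrow> cond_eval a s t (P t) = P s)"

end

theory Submission
  imports Defs
begin

text \<open>
  In terms of the formal cumulants, \<open>f(u.\<alpha>, z) = exp (u G)\<close> and
  \<open>f(- t.\<beta>.\<kappa>, z) = exp (- t G)\<close> with \<open>G = f(\<kappa>, z) - 1\<close>.  So both \<open>Q\<close> and the conditional
  evaluation of a power are Appell polynomials, with generating functions
  \<open>exp (x z - t G)\<close> and \<open>exp (x z + (t - s) G)\<close>.  Evaluating the former conditionally multiplies
  the two factors free of \<open>x\<close>, which gives \<open>exp (- t G) exp ((t - s) G) = exp (- s G)\<close>.
\<close>

lemma fps_exp_compose_const_mult:
  fixes G :: "'a::field_char_0 fps"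
  assumes "fps_nth G 0 = 0"
  shows "fps_exp 1 oo (fps_const c * G) = fps_exp c oo G"
proof -
  have "fps_exp 1 oo ((fps_const c * fps_X) oo G) = (fps_exp 1 oo (fps_const c * fps_X)) oo G"
    by (rule fps_compose_assoc) (use assms in auto)
  then show ?thesis
    using assms by (simp add: fps_compose_mult_distrib)
qed

text \<open>Since \<open>fps_binomial c\<close> is the series of \<open>(1 + z)^c\<close>, this is
  the formal identity behind \<open>(e^z)^c = e^(c z)\<close>. Both sides solve
  \<open>F' = c F\<close> with constant term 1.\<close>

lemma fps_binomial_compose_exp_minus_1:
  fixes c :: "'a::field_char_0"
  shows "fps_binomial c oo (fps_exp 1 - 1) = fps_exp c"
proof -
  let ?E = "fps_exp (1::'a) - 1"
  have E0: "fps_nth ?E 0 = 0"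
    by simp
  \<comment> \<open>The inner derivative \<open>fps_exp 1\<close> is written as
    \<open>1 + fps_X\<close> composed with \<open>?E\<close>, ready to cancel the denominator in the
    derivative of the binomial series.\<close>
  have "fps_deriv (fps_binomial c oo ?E) = (fps_deriv (fps_binomial c) oo ?E) * ((1 + fps_X) oo ?E)"
    by (simp add: fps_compose_deriv fps_compose_add_distrib)
  also have "\<dots> = (fps_deriv (fps_binomial c) * (1 + fps_X)) oo ?E"
    by (rule fps_compose_mult_distrib [OF E0, symmetric])
  also have "fps_deriv (fps_binomial c) * (1 + fps_X) = fps_const c * fps_binomial c"
    by (simp add: fps_binomial_deriv fps_divide_unit mult.assoc inverse_mult_eq_1)
  finally have "fps_deriv (fps_binomial c oo ?E) = fps_const c * (fps_binomial c oo ?E)"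
    by (simp add: fps_compose_mult_distrib)
  then show ?thesis
    by (simp add: fps_exp_unique_ODE)
qed

lemma fps_real_power_fps_expo:
  assumes "fps_nth G 0 = 0"
  shows "fps_real_power (fps_expo G) c = fps_exp c oo G"
proof -
  have "fps_real_power (fps_expo G) c = fps_binomial c oo ((fps_exp 1 - 1) oo G)"
    by (simp add: fps_real_power_def fps_expo_def fps_compose_sub_distrib)
  also have "\<dots> = (fps_binomial c oo (fps_exp 1 - 1)) oo G"
    by (rule fps_compose_assoc) (use assms in auto)
  finally show ?thesis
    by (simp add: fps_binomial_compose_exp_minus_1)
qed

text \<open>This is \<open>k!\<close> times the coefficient of \<open>z^k\<close> in
  \<open>U(z) exp(x z)\<close>.\<close>

definition appell :: "real fps \<Rightarrow> nat \<Rightarrow> real poly" where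
  "appell U k = (\<Sum>j\<le>k. monom (fact k / fact j * fps_nth U (k - j)) j)"

lemma coeff_appell:
  "coeff (appell U k) j = (if j \<le> k then fact k / fact j * fps_nth U (k - j) else 0)"
  by (simp add: appell_def coeff_sum)

lemma degree_appell_le: "degree (appell U k) \<le> k"
  by (rule degree_le) (simp add: coeff_appell)

lemma umbral_eval_linear_power:
  "umbral_eval (umbra_of U) ([:[:0, 1:], 1:] ^ k) = appell U k"
proof -
  have "umbral_eval (umbra_of U) ([:[:0, 1:], 1:] ^ k)
      = (\<Sum>i\<le>k. monom (fact i * fps_nth U i * of_nat (k choose i)) (k - i))"
    unfolding umbral_eval_def
    by (intro sum.cong)
       (simp_all add: degree_linear_power coeff_linear_poly_power umbra_of_def monom_altdef of_nat_poly)
  \<comment> \<open>The index passes from the exponent of the umbra to that of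
    \<open>x\<close>.\<close>
  also have "\<dots> = (\<Sum>j\<le>k. monom (fact (k - j) * fps_nth U (k - j) * of_nat (k choose (k - j))) j)"
    by (rule sum.reindex_bij_witness [of _ "\<lambda>j. k - j" "\<lambda>j. k - j"]) auto
  also have "\<dots> = appell U k"
    unfolding appell_def by (intro sum.cong) (simp_all add: binomial_fact)
  finally show ?thesis .
qed

lemma cond_eval_power_eq_appell:
  "cond_eval_power a s t k = appell (fps_real_power (gen_fun a) (t - s)) k"
  unfolding cond_eval_power_def appell_def dot_def umbra_of_def
  by (intro sum.cong) (simp_all add: binomial_fact)

text \<open>Lets the sum run to \<open>k\<close> for an Appell polynomial, given only a bound on its
  degree.\<close>

lemma cond_eval_eq_sum:
  assumes "degree p \<le> n"
  shows "cond_eval a s t p = (\<Sum>k\<le>n. smult (coeff p k) (cond_eval_power a s t k))"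
  unfolding cond_eval_def
  using assms by (intro sum.mono_neutral_left) (auto simp: coeff_eq_0)

text \<open>Replacing each \<open>x^i\<close> by \<open>appell V i\<close> turns
  \<open>exp(x z)\<close> into \<open>V(z) exp(x z)\<close> and leaves the factor
  \<open>U(z)\<close>, which is free of \<open>x\<close>, unchanged.\<close>

lemma sum_appell:
  "(\<Sum>i\<le>k. smult (coeff (appell U k) i) (appell V i)) = appell (U * V) k"
proof (rule poly_eqI)
  fix j
  have "coeff (\<Sum>i\<le>k. smult (coeff (appell U k) i) (appell V i)) j
      = (\<Sum>i\<le>k. if j \<le> i then fact k / fact j * (fps_nth U (k - i) * fps_nth V (i - j)) else 0)"
    unfolding coeff_sum by (intro sum.cong) (simp_all add: coeff_appell)
  also have "\<dots> = (\<Sum>i=j..k. fact k / fact j * (fps_nth U (k - i) * fps_nth V (i - j)))"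
    by (rule sum.mono_neutral_cong_right) auto
  also have "\<dots> = coeff (appell (U * V) k) j"
  proof (cases "j \<le> k")
    case True
    \<comment> \<open>With \<open>m = k - i\<close> the sum becomes the Cauchy product coefficient
      at \<open>k - j\<close>.\<close>
    have "(\<Sum>i=j..k. fps_nth U (k - i) * fps_nth V (i - j))
        = (\<Sum>m=0..k - j. fps_nth U m * fps_nth V (k - j - m))"
      using True by (intro sum.reindex_bij_witness [of _ "\<lambda>m. k - m" "\<lambda>i. k - i"]) auto
    with True show ?thesis
      by (simp only: coeff_appell fps_mult_nth sum_distrib_left [symmetric] if_True)
  qed (simp add: coeff_appell)
  finally show "coeff (\<Sum>i\<le>k. smult (coeff (appell U k) i) (appell V i)) j
      = coeff (appell (U * V) k) j" .
qed

theorem theorem4p6: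
  fixes a :: "nat \<Rightarrow> real"
  assumes "is_umbra a"
  shows "\<forall>k::nat. time_space_harmonic a (\<lambda>t. Q a k t)"
proof -
  define G where "G = gen_fun (cumulant_umbra a) - 1"
  have "is_cumulant_umbra a (cumulant_umbra a)"
    using assms by (rule cumulant_umbra)
  then have G0: "fps_nth G 0 = 0" and a: "gen_fun a = fps_expo G"
    by (simp_all add: is_cumulant_umbra_def G_def gen_fun_nth_0)
  have Q: "Q a k t = appell (fps_exp (- t) oo G) k" for k t
    unfolding Q_def dot_bell_dot_def umbral_eval_linear_power
    using fps_exp_compose_const_mult [OF G0, of "- t"] by (simp add: fps_expo_def G_def)
  have "cond_eval a s t (Q a k t) = Q a k s" for k s t
  proof -
    have "cond_eval a s t (Q a k t)
        = appell ((fps_exp (- t) oo G) * (fps_exp (t - s) oo G)) k"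
      unfolding Q cond_eval_eq_sum [OF degree_appell_le] cond_eval_power_eq_appell a
        fps_real_power_fps_expo [OF G0] by (rule sum_appell)
    also have "(fps_exp (- t) oo G) * (fps_exp (t - s) oo G) = fps_exp (- s) oo G"
      by (simp add: fps_compose_mult_distrib [OF G0, symmetric] fps_exp_add_mult [symmetric])
    finally show ?thesis
      by (simp add: Q)
  qed
  then show ?thesis
    by (simp add: time_space_harmonic_def)
qed

end
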